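(* Let $\ell,n\ge1$ be integers and fix $\ell$-multicompositions $\mu,\nu\vDash_\ell n$. There is a natural bijection $$\mathrm{BCM}_\ell(\nu,\mu)\ \longleftrightarrow\ \mathrm{BW}_\ell(\nu,\mu)$$ between flagged block composition matrices and $(\nu,\mu)$-flagged biwords.
   Context: Compositions. A composition is a vector $\alpha=(\alpha_1,\dots,\alpha_k)$ of nonnegative integers, with $|\alpha|=\sum_i\alpha_i$; its length is its number of parts $k$, and the empty composition is allowed. An $\ell$-multicomposition of $n$, written $\mu\vDash_\ell n$, is an $\ell$-tuple $\mu=(\mu^{(1)},\dots,\mu^{(\ell)})$ of compositions with $\sum_i|\mu^{(i)}|=n$; an absent part of $\mu^{(i)}$ is interpreted as $0$. The set $\mathrm{BCM}_\ell(\nu,\mu)$. It consists of all flagged $\ell\times\ell$ block composition matrices with row sum $\nu$ and column sum $\mu$, that is, all collections $B=\{B^{(pq)}\}_{1\le p,q\le\ell}$ of matrices $B^{(pq)}=(b^{(pq)}_{ij})_{i,j\ge1}$ whose entries are compositions, all but finitely many equal to the empty composition, such that $\mathrm{length}(b^{(pq)}_{ij})\le\min(p,q)$ for all $p,q,i,j$, and $\sum_{q=1}^{\ell}\sum_j|b^{(sq)}_{tj}|=\nu^{(s)}_t$, $\sum_{p=1}^{\ell}\sum_i|b^{(ps)}_{it}|=\mu^{(s)}_t$ for all $1\le s\le\ell$, $t\ge1$. Letters. $\mathcal S=\{a_b: a,b\in\{1,2,3,\dots\}\}$ is totally ordered by $1_1<2_1<3_1<\cdots<1_2<2_2<3_2<\cdots<1_3<2_3<\cdots$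 (compare subscripts first, then $a$). For $\mu\vDash_\ell n$, the $\mu$-alphabet is the finite multiset of letters of $\mathcal S$ in which $a_b$ ($a\ge1$, $1\le b\le\ell$) occurs with multiplicity $\mu^{(b)}_a$, and no other letters occur. Flagged biwords. A biword over $\mathcal S$ is a finite array $\begin{pmatrix}\alpha_1&\cdots&\alpha_k\\ \beta_1&\cdots&\beta_k\end{pmatrix}$ ($k\ge0$) with entries in $\mathcal S$, with $\alpha_1\le\cdots\le\alpha_k$, and $\beta_i\le\beta_{i+1}$ whenever $\alpha_i=\alpha_{i+1}$. The set $\mathrm{BW}_\ell(\nu,\mu)$ of $(\nu,\mu)$-flagged biwords consists of all $\ell$-tuples $w=(w^{(1)},\dots,w^{(\ell)})$ of biwords over $\mathcal S$ such that: (1) if the letter $a_b$ appears in $w^{(i)}$ then $b\ge i$; (2) the multiset union of the top rows of $w^{(1)},\dots,w^{(\ell)}$ is the $\nu$-alphabet; (3) the multiset union of the bottom rows of $w^{(1)},\dots,w^{(\ell)}$ is the $\mu$-alphabet.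
   Formalization: Matrix entries are compositions up to trailing zeros (represented without them, so no entry ends in 0); if (), (0), (0,0) counted as distinct entries, the set of block composition matrices could be infinite while the set of biwords is finite. *)

theory Defs
  imports "HOL-Library.Multiset"
begin

text \<open>
  All indices are 1-based, as in the mathematics: \<open>part \<alpha> t\<close> is \<open>\<alpha>\<^sub>t\<close>,
  with absent parts read as 0.  The component \<open>\<mu>\<^sup>(\<^sup>s\<^sup>)\<close> of a tuple (a list) is \<open>\<mu> ! (s - 1)\<close>.
\<close>

definition part :: "nat list \<Rightarrow> nat \<Rightarrow> nat" where
  "part \<alpha> t = (if 1 \<le> t \<and> t \<le> length \<alpha> then \<alpha> ! (t - 1) else 0)"

definition multicomposition :: "nat \<Rightarrow> nat \<Rightarrow> nat list list \<Rightarrow> bool" where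
  "multicomposition l n \<mu> \<longleftrightarrow> length \<mu> = l \<and> sum_list (map sum_list \<mu>) = n"

text \<open>
  Since absent parts are 0, compositions occurring as matrix entries are taken up to trailing
  zeros.  Each class is represented by its member without trailing zeros, which is the
  shortest one, so a bound on its length is a bound on the index of the last nonzero part.
  (If \<open>[]\<close>, \<open>[0]\<close>, \<open>[0, 0]\<close>, ... counted as different entries, they would be different
  matrix entries with the same sum and the same parts, and the set of block composition
  matrices could be infinite.)
\<close>

definition reduced :: "nat list \<Rightarrow> bool" where
  "reduced \<alpha> \<longleftrightarrow> \<alpha> = [] \<or> last \<alpha> \<noteq> 0"

text \<open>
  \<open>B p q i j\<close> is the entry in row \<open>i\<close> and column \<open>j\<close> of the block \<open>(p, q)\<close>.  Outside the index
  range \<open>B\<close> is required to be \<open>[]\<close>, so that equality of functions is equality of matrices.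
  The sums over \<open>j\<close> and \<open>i\<close> omit the empty entries, whose size is 0; this leaves finite sums.
\<close>

definition BCM ::
  "nat \<Rightarrow> nat list list \<Rightarrow> nat list list \<Rightarrow> (nat \<Rightarrow> nat \<Rightarrow> nat \<Rightarrow> nat \<Rightarrow> nat list) set" where
  "BCM l \<nu> \<mu> = {B.
     (\<forall>p q i j. \<not> (p \<in> {1..l} \<and> q \<in> {1..l} \<and> 1 \<le> i \<and> 1 \<le> j) \<longrightarrow> B p q i j = []) \<and>
     (\<forall>p\<in>{1..l}. \<forall>q\<in>{1..l}. finite {(i, j). 1 \<le> i \<and> 1 \<le> j \<and> B p q i j \<noteq> []}) \<and>
     (\<forall>p\<in>{1..l}. \<forall>q\<in>{1..l}. \<forall>i\<ge>1. \<forall>j\<ge>1.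
        reduced (B p q i j) \<and> length (B p q i j) \<le> min p q) \<and>
     (\<forall>s\<in>{1..l}. \<forall>t\<ge>1.
        (\<Sum>q=1..l. \<Sum>j\<in>{j. 1 \<le> j \<and> B s q t j \<noteq> []}. sum_list (B s q t j)) = part (\<nu> ! (s - 1)) t) \<and>
     (\<forall>s\<in>{1..l}. \<forall>t\<ge>1.
        (\<Sum>p=1..l. \<Sum>i\<in>{i. 1 \<le> i \<and> B p s i t \<noteq> []}. sum_list (B p s i t)) = part (\<mu> ! (s - 1)) t)}"

text \<open>\<open>Letter a b\<close> is the letter \<open>a\<^sub>b\<close>.\<close>

datatype letter = Letter (base: nat) (sub: nat)

definition letters :: "letter set" where
  "letters = {Letter a b |a b. 1 \<le> a \<and> 1 \<le> b}"

instantiation letter :: linorder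
begin

definition less_eq_letter :: "letter \<Rightarrow> letter \<Rightarrow> bool" where
  "x \<le> y \<longleftrightarrow> sub x < sub y \<or> (sub x = sub y \<and> base x \<le> base y)"

definition less_letter :: "letter \<Rightarrow> letter \<Rightarrow> bool" where
  "x < y \<longleftrightarrow> sub x < sub y \<or> (sub x = sub y \<and> base x < base y)"

instance
  by standard (auto simp: less_eq_letter_def less_letter_def intro: letter.expand)

end

definition alphabet :: "nat list list \<Rightarrow> letter multiset" where
  "alphabet \<mu> = (\<Sum>b=1..length \<mu>. \<Sum>a=1..length (\<mu> ! (b - 1)).
     replicate_mset (part (\<mu> ! (b - 1)) a) (Letter a b))"

lemma count_alphabet:
  "count (alphabet \<mu>) (Letter a b) =
     (if 1 \<le> a \<and> 1 \<le> b \<and> b \<le> length \<mu> then part (\<mu> ! (b - 1)) a else 0)"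
proof -
  have "count (alphabet \<mu>) (Letter a b) =
      (\<Sum>b'=1..length \<mu>. \<Sum>a'=1..length (\<mu> ! (b' - 1)).
         if b' = b then if a' = a then part (\<mu> ! (b' - 1)) a' else 0 else 0)"
    unfolding alphabet_def count_sum by (intro sum.cong refl) auto
  also have "\<dots> = (\<Sum>b'=1..length \<mu>. if b' = b then
      (\<Sum>a'=1..length (\<mu> ! (b - 1)). if a' = a then part (\<mu> ! (b - 1)) a' else 0) else 0)"
    by (intro sum.cong refl) auto
  also have "\<dots> = (if 1 \<le> a \<and> 1 \<le> b \<and> b \<le> length \<mu> then part (\<mu> ! (b - 1)) a else 0)"
    by (auto simp: part_def)
  finally show ?thesis .
qed

text \<open>A biword is the list of its columns (top letter, bottom letter).\<close>

definition biword :: "(letter \<times> letter) list \<Rightarrow> bool" where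
  "biword w \<longleftrightarrow> set w \<subseteq> letters \<times> letters \<and>
     (\<forall>k. Suc k < length w \<longrightarrow> fst (w ! k) \<le> fst (w ! Suc k) \<and>
        (fst (w ! k) = fst (w ! Suc k) \<longrightarrow> snd (w ! k) \<le> snd (w ! Suc k)))"

definition BW ::
  "nat \<Rightarrow> nat list list \<Rightarrow> nat list list \<Rightarrow> (letter \<times> letter) list list set" where
  "BW l \<nu> \<mu> = {w. length w = l \<and>
     (\<forall>i\<in>{1..l}. biword (w ! (i - 1))) \<and>
     (\<forall>i\<in>{1..l}. \<forall>(x, y)\<in>set (w ! (i - 1)). i \<le> sub x \<and> i \<le> sub y) \<and>
     (\<Sum>i=1..l. mset (map fst (w ! (i - 1)))) = alphabet \<nu> \<and>
     (\<Sum>i=1..l. mset (map snd (w ! (i - 1)))) = alphabet \<mu>}"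

text \<open>
  The natural correspondence: the column with top letter \<open>i\<^sub>p\<close> and bottom letter \<open>j\<^sub>q\<close> occurs in
  the \<open>r\<close>-th biword as often as the \<open>r\<close>-th part of the entry \<open>(i, j)\<close> of the block \<open>(p, q)\<close>
  says.
\<close>

definition corresponds ::
  "nat \<Rightarrow> (nat \<Rightarrow> nat \<Rightarrow> nat \<Rightarrow> nat \<Rightarrow> nat list) \<Rightarrow> (letter \<times> letter) list list \<Rightarrow> bool" where
  "corresponds l B w \<longleftrightarrow> (\<forall>r\<in>{1..l}. \<forall>p\<in>{1..l}. \<forall>q\<in>{1..l}. \<forall>i\<ge>1. \<forall>j\<ge>1.
     count (mset (w ! (r - 1))) (Letter i p, Letter j q) = part (B p q i j) r)"

end

theory Submission
  imports Defs "HOL-Library.Product_Lexorder"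
begin

text \<open>
  Index the entries of a block composition matrix by columns \<open>(i\<^sub>p, j\<^sub>q)\<close> of biwords.  A flagged
  biword tuple is then the same as the family of multiplicities of the columns, since a biword is a
  lexicographically sorted list, and a reduced composition is the same as its family of parts.  The
  \<open>r\<close>-th part of an entry is the multiplicity in the \<open>r\<close>-th biword; the bound \<open>min p q\<close> on the
  length is the flag condition, and summing over all columns with a given top (bottom) letter turns
  the row (column) sums into letter multiplicities.
\<close>

section \<open>Compositions and their parts\<close>

lemma part_beyond: "length \<alpha> < t \<Longrightarrow> part \<alpha> t = 0"
  by (simp add: part_def)

lemma part_Nil [simp]: "part [] t = 0"
  by (simp add: part_def)

text \<open>A common upper bound \<open>l\<close> in place of the length allows sums over biwords
  and over entries to be swapped later; the extra parts are 0.\<close>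

lemma sum_part:
  assumes "length \<alpha> \<le> l"
  shows "(\<Sum>r=1..l. part \<alpha> r) = sum_list \<alpha>"
proof -
  have "(\<Sum>r=1..l. part \<alpha> r) = (\<Sum>r=1..length \<alpha>. part \<alpha> r)"
    using assms by (intro sum.mono_neutral_right) (auto simp: part_def)
  also have "\<dots> = (\<Sum>k=0..<length \<alpha>. \<alpha> ! k)"
    by (rule sum.reindex_bij_witness[of _ Suc "\<lambda>r. r - 1"]) (auto simp: part_def)
  finally show ?thesis
    by (simp add: sum_list_sum_nth)
qed

lemma reduced_part_last:
  assumes "reduced \<alpha>" "\<alpha> \<noteq> []"
  shows "part \<alpha> (length \<alpha>) \<noteq> 0"
  using assms by (simp add: reduced_def part_def last_conv_nth Suc_le_eq)

text \<open>If \<alpha> is nonempty, its part at index \<open>length \<alpha>\<close> is nonzero, so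
  that index cannot exceed \<open>m\<close>.\<close>

lemma reduced_length_le:
  assumes "reduced \<alpha>" "\<And>r. m < r \<Longrightarrow> part \<alpha> r = 0"
  shows "length \<alpha> \<le> m"
  by (metis assms reduced_part_last leI list.size(3) zero_le)

text \<open>Trailing zeros are invisible to \<open>part\<close>; once they are excluded, the parts
  determine the length as well.\<close>

lemma reduced_eqI:
  assumes "reduced \<alpha>" "reduced \<beta>" "\<And>r. 1 \<le> r \<Longrightarrow> part \<alpha> r = part \<beta> r"
  shows "\<alpha> = \<beta>"
proof (rule nth_equalityI)
  have "part \<alpha> r = 0" if "length \<beta> < r" for r
    using assms(3)[of r] that by (simp add: part_beyond)
  moreover have "part \<beta> r = 0" if "length \<alpha> < r" for r
    using assms(3)[of r] that by (simp add: part_beyond)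
  ultimately have "length \<alpha> \<le> length \<beta>" "length \<beta> \<le> length \<alpha>"
    using assms(1,2) by (blast intro: reduced_length_le)+
  then show len: "length \<alpha> = length \<beta>" by simp
  show "\<alpha> ! k = \<beta> ! k" if "k < length \<alpha>" for k
    using assms(3)[of "Suc k"] that len by (simp add: part_def)
qed

text \<open>The witness is \<open>g 1, ..., g m\<close> with trailing zeros cut off. If
  \<open>g (Suc m)\<close> is 0, the witness for \<open>m\<close> still serves; otherwise the full
  list is already reduced.\<close>

lemma ex_reduced_parts:
  "\<exists>\<alpha>. reduced \<alpha> \<and> length \<alpha> \<le> m \<and> (\<forall>r\<in>{1..m}. part \<alpha> r = g r)"
proof (induction m)
  case 0
  show ?case by (auto simp: reduced_def)
next
  case (Suc m)
  then obtain \<alpha> where \<alpha>: "reduced \<alpha>" "length \<alpha> \<le> m" "\<forall>r\<in>{1..m}. part \<alpha> r = g r"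
    by blast
  show ?case
  proof (cases "g (Suc m) = 0")
    case True
    then show ?thesis
      using \<alpha> by (intro exI[of _ \<alpha>]) (auto simp: le_Suc_eq part_beyond)
  next
    case False
    have "reduced (map g [1..<Suc (Suc m)])"
      using False by (simp add: reduced_def)
    then show ?thesis
      by (intro exI[of _ "map g [1..<Suc (Suc m)]"])
        (auto simp: part_def nth_append simp del: upt_Suc)
  qed
qed

section \<open>Biwords\<close>

text \<open>Pairs carry the lexicographic order here, so a biword is determined by the multiset of
  its columns.\<close>

lemma biword_iff_sorted: "biword w \<longleftrightarrow> set w \<subseteq> letters \<times> letters \<and> sorted w"
proof -
  have "x \<le> y \<longleftrightarrow> fst x \<le> fst y \<and> (fst x = fst y \<longrightarrow> snd x \<le> snd y)" for x y :: "letter \<times> letter"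
    by (auto simp: less_eq_prod_def)
  then show ?thesis
    by (auto simp: biword_def sorted_iff_nth_Suc)
qed

lemma mem_letters: "x \<in> letters \<longleftrightarrow> 1 \<le> base x \<and> 1 \<le> sub x"
  by (cases x) (auto simp: letters_def)

text \<open>For indices outside the range, both multiplicities vanish, so only the listed letters
  need to be compared.\<close>

lemma alphabet_eq_iff:
  assumes "length \<mu> = l" "\<And>x. x \<in># A \<Longrightarrow> x \<in> letters \<and> sub x \<le> l"
  shows "A = alphabet \<mu> \<longleftrightarrow>
    (\<forall>s\<in>{1..l}. \<forall>t\<ge>1. count A (Letter t s) = part (\<mu> ! (s - 1)) t)"
proof -
  have "count A (Letter t s) = count (alphabet \<mu>) (Letter t s) \<longleftrightarrow>
      (s \<in> {1..l} \<and> 1 \<le> t \<longrightarrow> count A (Letter t s) = part (\<mu> ! (s - 1)) t)" for t s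
    using assms(2)[of "Letter t s"] not_in_iff[of "Letter t s" A] assms(1)
    by (auto simp: count_alphabet mem_letters)
  then show ?thesis
    unfolding multiset_eq_iff by (metis letter.exhaust)
qed

lemma mem_alphabetD: "x \<in># alphabet \<mu> \<Longrightarrow> sub x \<le> length \<mu>"
  by (cases x) (auto simp: count_alphabet simp flip: count_greater_zero_iff split: if_splits)

section \<open>Matrices and tuples without the sum conditions\<close>

definition BCM_shape :: "nat \<Rightarrow> (nat \<Rightarrow> nat \<Rightarrow> nat \<Rightarrow> nat \<Rightarrow> nat list) \<Rightarrow> bool" where
  "BCM_shape l B \<longleftrightarrow>
     (\<forall>p q i j. \<not> (p \<in> {1..l} \<and> q \<in> {1..l} \<and> 1 \<le> i \<and> 1 \<le> j) \<longrightarrow> B p q i j = []) \<and>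
     (\<forall>p\<in>{1..l}. \<forall>q\<in>{1..l}. finite {(i, j). 1 \<le> i \<and> 1 \<le> j \<and> B p q i j \<noteq> []}) \<and>
     (\<forall>p\<in>{1..l}. \<forall>q\<in>{1..l}. \<forall>i\<ge>1. \<forall>j\<ge>1.
        reduced (B p q i j) \<and> length (B p q i j) \<le> min p q)"

text \<open>The upper bounds on the subscripts stand in for what the two alphabet conditions would
  force.\<close>

definition BW_shape :: "nat \<Rightarrow> (letter \<times> letter) list list \<Rightarrow> bool" where
  "BW_shape l w \<longleftrightarrow> length w = l \<and> (\<forall>r\<in>{1..l}. biword (w ! (r - 1)) \<and>
     (\<forall>(x, y)\<in>set (w ! (r - 1)). r \<le> sub x \<and> r \<le> sub y \<and> sub x \<le> l \<and> sub y \<le> l))"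

lemma BW_shape_mem:
  assumes "BW_shape l w" "r \<in> {1..l}" "(x, y) \<in> set (w ! (r - 1))"
  shows "x \<in> letters \<and> y \<in> letters \<and> r \<le> sub x \<and> r \<le> sub y \<and> sub x \<le> l \<and> sub y \<le> l"
proof -
  have "biword (w ! (r - 1))" and
      "\<forall>(x, y)\<in>set (w ! (r - 1)). r \<le> sub x \<and> r \<le> sub y \<and> sub x \<le> l \<and> sub y \<le> l"
    using assms(1,2) unfolding BW_shape_def by blast+
  then show ?thesis
    using assms(3) unfolding biword_def by blast
qed

definition entry ::
  "(nat \<Rightarrow> nat \<Rightarrow> nat \<Rightarrow> nat \<Rightarrow> nat list) \<Rightarrow> letter \<times> letter \<Rightarrow> nat list" where
  "entry B c = B (sub (fst c)) (sub (snd c)) (base (fst c)) (base (snd c))"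

lemma entry_Letter [simp]: "entry B (Letter i p, Letter j q) = B p q i j"
  by (simp add: entry_def)

text \<open>No range assumption on the letters is needed: entries out of range are
  \<open>[]\<close>, which is reduced and of length 0.\<close>

lemma BCM_shape_entry:
  assumes "BCM_shape l B"
  shows "reduced (entry B (x, y))" "length (entry B (x, y)) \<le> min (sub x) (sub y)"
    and "entry B (x, y) \<noteq> [] \<Longrightarrow> x \<in> letters \<and> y \<in> letters \<and> sub x \<le> l \<and> sub y \<le> l"
proof -
  have "\<not> (sub x \<in> {1..l} \<and> sub y \<in> {1..l} \<and> 1 \<le> base x \<and> 1 \<le> base y) \<Longrightarrow> entry B (x, y) = []"
    using assms unfolding BCM_shape_def entry_def fst_conv snd_conv by (elim conjE allE impE)
  then show *: "entry B (x, y) \<noteq> [] \<Longrightarrow> x \<in> letters \<and> y \<in> letters \<and> sub x \<le> l \<and> sub y \<le> l"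
    unfolding mem_letters by force
  have "reduced (entry B (x, y)) \<and> length (entry B (x, y)) \<le> min (sub x) (sub y)"
  proof (cases "entry B (x, y) = []")
    case True
    then show ?thesis by (simp add: reduced_def)
  next
    case False
    show ?thesis
      using *[OF False] assms by (simp add: BCM_shape_def entry_def mem_letters)
  qed
  then show "reduced (entry B (x, y))" "length (entry B (x, y)) \<le> min (sub x) (sub y)"
    by blast+
qed

lemma finite_entry:
  assumes "BCM_shape l B"
  shows "finite {c. entry B c \<noteq> []}"
proof (rule finite_subset)
  let ?S = "\<lambda>p q. {(i, j). 1 \<le> i \<and> 1 \<le> j \<and> B p q i j \<noteq> []}"
  let ?U = "\<Union>p\<in>{1..l}. \<Union>q\<in>{1..l}. (\<lambda>(i, j). (Letter i p, Letter j q)) ` ?S p q"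
  show "finite ?U"
    using assms by (auto simp: BCM_shape_def)
  show "{c. entry B c \<noteq> []} \<subseteq> ?U"
  proof
    fix c assume c: "c \<in> {c. entry B c \<noteq> []}"
    obtain i p j q where [simp]: "c = (Letter i p, Letter j q)"
      by (metis letter.exhaust surj_pair)
    show "c \<in> ?U"
      using c BCM_shape_entry(3)[OF assms, of "Letter i p" "Letter j q"]
      by (intro UN_I[of p] UN_I[of q] image_eqI[of _ _ "(i, j)"]) (auto simp: mem_letters)
  qed
qed

section \<open>Uniqueness of the corresponding partner\<close>

text \<open>Extends \<open>corresponds\<close> to all columns: out of range the entry is empty, and
  the column cannot occur in a tuple of the right shape.\<close>

lemma count_eq_part_entry:
  assumes "BCM_shape l B" "BW_shape l w" "corresponds l B w" "r \<in> {1..l}"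
  shows "count (mset (w ! (r - 1))) c = part (entry B c) r"
proof -
  obtain i p j q where [simp]: "c = (Letter i p, Letter j q)"
    by (metis letter.exhaust surj_pair)
  show ?thesis
  proof (cases "p \<in> {1..l} \<and> q \<in> {1..l} \<and> 1 \<le> i \<and> 1 \<le> j")
    case True
    then show ?thesis using assms(3,4) by (auto simp: corresponds_def)
  next
    case False
    then have "B p q i j = []" using assms(1) by (auto simp: BCM_shape_def)
    moreover have "c \<notin># mset (w ! (r - 1))"
      using False BW_shape_mem[OF assms(2,4), of "Letter i p" "Letter j q"]
      by (auto simp: mem_letters)
    ultimately show ?thesis by (simp add: not_in_iff del: set_mset_mset)
  qed
qed

lemma BCM_shape_unique:
  assumes "BCM_shape l B" "BCM_shape l B'" "BW_shape l w" "corresponds l B w" "corresponds l B' w"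
  shows "B = B'"
proof -
  have "part (entry B (x, y)) r = part (entry B' (x, y)) r" if "1 \<le> r" for x y r
  proof (cases "r \<le> l")
    case True
    then have "r \<in> {1..l}" using that by simp
    then show ?thesis
      using count_eq_part_entry assms by metis
  next
    case False
    \<comment> \<open>\<open>corresponds\<close> says nothing about \<open>r > l\<close>, but there
      both parts are 0.\<close>
    have "length (entry C (x, y)) \<le> l" if "BCM_shape l C" for C
      using BCM_shape_entry(2,3)[OF that, of x y] by fastforce
    then show ?thesis
      using False assms(1,2) by (metis le_less_trans linorder_not_le part_beyond)
  qed
  then have "entry B (x, y) = entry B' (x, y)" for x y
    using assms by (blast intro: reduced_eqI BCM_shape_entry)
  then have "B p q i j = B' p q i j" for p q i j
    by (metis entry_Letter)
  then show ?thesis by blast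
qed

lemma BW_shape_unique:
  assumes "BCM_shape l B" "BW_shape l w" "BW_shape l w'" "corresponds l B w" "corresponds l B w'"
  shows "w = w'"
proof (rule nth_equalityI)
  show "length w = length w'" using assms by (simp add: BW_shape_def)
  fix k assume "k < length w"
  then have k: "Suc k \<in> {1..l}" using assms by (simp add: BW_shape_def)
  have "mset (w ! k) = mset (w' ! k)"
    using count_eq_part_entry[OF assms(1) _ _ k] assms by (simp add: multiset_eq_iff)
  moreover have "biword (w ! k)" "biword (w' ! k)"
    using assms(2,3) k unfolding BW_shape_def by (metis diff_Suc_1)+
  then have "sorted (w ! k)" "sorted (w' ! k)"
    by (simp_all add: biword_iff_sorted)
  ultimately show "w ! k = w' ! k"
    by (metis properties_for_sort)
qed

section \<open>Existence of the corresponding partner\<close>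

lemma ex_BW_shape:
  assumes "BCM_shape l B"
  shows "\<exists>w. BW_shape l w \<and> corresponds l B w"
proof -
  \<comment> \<open>The function has finite support by \<open>finite_entry\<close>, so
    \<open>M r\<close> really has these multiplicities.\<close>
  define M where "M r = Abs_multiset (\<lambda>c. part (entry B c) r)" for r
  have M: "count (M r) c = part (entry B c) r" for r c
    unfolding M_def
    by (subst count_Abs_multiset)
      (auto intro: finite_subset[OF _ finite_entry[OF assms]])
  define w where "w = map (\<lambda>r. sorted_list_of_multiset (M r)) [1..<Suc l]"
  have length_w: "length w = l" by (simp add: w_def)
  have nth: "w ! (r - 1) = sorted_list_of_multiset (M r)" if "r \<in> {1..l}" for r
    using that by (auto simp: w_def simp del: upt_Suc)
  have "x \<in> letters \<and> y \<in> letters \<and> r \<le> sub x \<and> r \<le> sub y \<and> sub x \<le> l \<and> sub y \<le> l"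
    if "(x, y) \<in># M r" for x y r
  proof -
    \<comment> \<open>A nonzero \<open>r\<close>-th part forces length at least \<open>r\<close>;
      with the bound \<open>min (sub x) (sub y)\<close> this is the flag condition.\<close>
    have "part (entry B (x, y)) r \<noteq> 0" using that M by (metis count_eq_zero_iff)
    then have "entry B (x, y) \<noteq> []" "r \<le> length (entry B (x, y))"
      by (auto simp: part_def split: if_splits)
    then show ?thesis using BCM_shape_entry[OF assms, of x y] by auto
  qed
  then have "BW_shape l w"
    using length_w by (auto simp: BW_shape_def nth biword_iff_sorted simp del: One_nat_def)
  moreover have "corresponds l B w"
    by (auto simp: corresponds_def nth M simp del: One_nat_def)
  ultimately show ?thesis by blast
qed

lemma ex_BCM_shape:
  assumes "BW_shape l w"
  shows "\<exists>B. BCM_shape l B \<and> corresponds l B w"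
proof -
  define g where "g p q i j r = count (mset (w ! (r - 1))) (Letter i p, Letter j q)" for p q i j r
  have "\<exists>\<alpha>. reduced \<alpha> \<and> length \<alpha> \<le> min p q \<and> (\<forall>r\<in>{1..min p q}. part \<alpha> r = g p q i j r)"
    for p q i j
    by (rule ex_reduced_parts)
  then obtain C where C: "reduced (C p q i j)" "length (C p q i j) \<le> min p q"
      "\<forall>r\<in>{1..min p q}. part (C p q i j) r = g p q i j r" for p q i j
    by metis
  define B where
    "B p q i j = (if p \<in> {1..l} \<and> q \<in> {1..l} \<and> 1 \<le> i \<and> 1 \<le> j then C p q i j else [])" for p q i j
  \<comment> \<open>The choice of \<open>C\<close> fixes parts only up to \<open>min p q\<close>.
    Beyond that the flag condition excludes the column, so the count is 0 too.\<close>
  have part: "part (C p q i j) r = g p q i j r" if "r \<in> {1..l}" for p q i j r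
  proof (cases "r \<le> min p q")
    case True
    then show ?thesis using C(3)[of p q i j] that by auto
  next
    case False
    then have "(Letter i p, Letter j q) \<notin> set (w ! (r - 1))"
      using BW_shape_mem[OF assms that, of "Letter i p" "Letter j q"] by auto
    moreover have "part (C p q i j) r = 0"
      using False C(2)[of p q i j] by (intro part_beyond) linarith
    ultimately show ?thesis by (simp add: g_def count_eq_zero_iff)
  qed
  have fin: "finite {(i, j). 1 \<le> i \<and> 1 \<le> j \<and> B p q i j \<noteq> []}" for p q
  proof (rule finite_subset)
    show "{(i, j). 1 \<le> i \<and> 1 \<le> j \<and> B p q i j \<noteq> []} \<subseteq>
        (\<Union>r\<in>{1..l}. (\<lambda>(x, y). (base x, base y)) ` set (w ! (r - 1)))"
    proof clarify
      fix i j assume ne: "B p q i j \<noteq> []"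
      \<comment> \<open>The last part of a nonempty reduced entry is nonzero, so the column occurs
        in biword number \<open>?r\<close>. Nonempty entries thus come from finitely many
        columns.\<close>
      let ?r = "length (C p q i j)"
      have C_ne: "C p q i j \<noteq> []" and pq: "p \<in> {1..l}" "q \<in> {1..l}"
        using ne by (auto simp: B_def split: if_splits)
      then have "?r \<in> {1..l}"
        using C(2)[of p q i j] by (auto simp: Suc_le_eq)
      moreover from this have "g p q i j ?r \<noteq> 0"
        using reduced_part_last[OF C(1) C_ne] part by simp
      then have "(Letter i p, Letter j q) \<in> set (w ! (?r - 1))"
        by (simp add: g_def count_eq_zero_iff)
      ultimately show
        "(i, j) \<in> (\<Union>r\<in>{1..l}. (\<lambda>(x, y). (base x, base y)) ` set (w ! (r - 1)))"
        by force
    qed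
  qed simp
  have "BCM_shape l B"
    unfolding BCM_shape_def
  proof (intro conjI)
    show "\<forall>p\<in>{1..l}. \<forall>q\<in>{1..l}. finite {(i, j). 1 \<le> i \<and> 1 \<le> j \<and> B p q i j \<noteq> []}"
      using fin by blast
  qed (use C(1,2) in \<open>auto simp: B_def\<close>)
  moreover have "corresponds l B w"
    using part by (simp add: corresponds_def B_def g_def)
  ultimately show ?thesis by blast
qed

section \<open>Row and column sums\<close>

text \<open>Double counting: the parts \<open>part (e c) r\<close> with \<open>f c = x\<close> are
  summed over \<open>c\<close> for each \<open>r\<close>, then over \<open>r\<close> for each
  \<open>c\<close>. Later \<open>f\<close> is \<open>fst\<close> or \<open>snd\<close>.\<close>

lemma count_image_sum_parts:
  fixes e :: "'a \<Rightarrow> nat list" and M :: "nat \<Rightarrow> 'a multiset"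
  assumes fin: "finite {c. e c \<noteq> []}" and len: "\<And>c. length (e c) \<le> l"
    and M: "\<And>r c. r \<in> {1..l} \<Longrightarrow> count (M r) c = part (e c) r"
  shows "count (\<Sum>r=1..l. image_mset f (M r)) x = (\<Sum>c\<in>{c. f c = x \<and> e c \<noteq> []}. sum_list (e c))"
proof -
  have "count (image_mset f (M r)) x = (\<Sum>c\<in>{c. f c = x \<and> e c \<noteq> []}. part (e c) r)"
    if r: "r \<in> {1..l}" for r
  proof -
    have "count (image_mset f (M r)) x = (\<Sum>c\<in>f -` {x} \<inter> set_mset (M r). part (e c) r)"
      using M r by (simp add: count_image_mset)
    \<comment> \<open>The enlarged index set does not depend on \<open>r\<close>, which permits the
      swap of sums; the added columns have \<open>r\<close>-th part 0.\<close>
    also have "\<dots> = (\<Sum>c\<in>{c. f c = x \<and> e c \<noteq> []}. part (e c) r)"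
    proof (rule sum.mono_neutral_left)
      show "finite {c. f c = x \<and> e c \<noteq> []}"
        using fin by (rule rev_finite_subset) auto
    qed (use M[OF r] in \<open>auto simp flip: count_greater_zero_iff\<close>)
    finally show ?thesis .
  qed
  then have "count (\<Sum>r=1..l. image_mset f (M r)) x =
      (\<Sum>r=1..l. \<Sum>c\<in>{c. f c = x \<and> e c \<noteq> []}. part (e c) r)"
    unfolding count_sum by (intro sum.cong) auto
  also have "\<dots> = (\<Sum>c\<in>{c. f c = x \<and> e c \<noteq> []}. \<Sum>r=1..l. part (e c) r)"
    by (rule sum.swap)
  finally show ?thesis
    using len by (simp only: sum_part)
qed

context
  fixes l B w
  assumes B: "BCM_shape l B" and w: "BW_shape l w" and corr: "corresponds l B w"
begin

lemma count_sum_image_entry: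
  "count (\<Sum>r=1..l. image_mset f (mset (w ! (r - 1)))) x =
     (\<Sum>c\<in>{c. f c = x \<and> entry B c \<noteq> []}. sum_list (entry B c))"
proof (rule count_image_sum_parts)
  show "length (entry B c) \<le> l" for c
    using BCM_shape_entry(2,3)[OF B, of "fst c" "snd c"] by fastforce
qed (use finite_entry count_eq_part_entry B w corr in auto)

lemma count_top:
  "count (\<Sum>r=1..l. mset (map fst (w ! (r - 1)))) (Letter t s) =
     (\<Sum>q=1..l. \<Sum>j\<in>{j. 1 \<le> j \<and> B s q t j \<noteq> []}. sum_list (B s q t j))"
proof -
  have fin: "finite {j. 1 \<le> j \<and> B s q t j \<noteq> []}" for q
    by (rule finite_subset[OF _ finite_imageI[OF finite_entry[OF B], of "\<lambda>c. base (snd c)"]])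
      (force intro: image_eqI[of _ _ "(Letter t s, Letter _ q)"])
  \<comment> \<open>With the top letter fixed, a column is given by \<open>(q, j)\<close>: these are
    the nonempty entries in row \<open>t\<close> of block row \<open>s\<close>.\<close>
  have "(\<Sum>c\<in>{c. fst c = Letter t s \<and> entry B c \<noteq> []}. sum_list (entry B c)) =
      (\<Sum>(q, j)\<in>(SIGMA q:{1..l}. {j. 1 \<le> j \<and> B s q t j \<noteq> []}). sum_list (B s q t j))"
    by (rule sum.reindex_bij_witness[of _ "\<lambda>(q, j). (Letter t s, Letter j q)"
            "\<lambda>c. (sub (snd c), base (snd c))"])
      (auto simp: entry_def mem_letters dest: BCM_shape_entry(3)[OF B, unfolded entry_def, simplified])
  then show ?thesis
    using fin by (simp add: count_sum_image_entry sum.Sigma del: One_nat_def)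
qed

lemma count_bottom:
  "count (\<Sum>r=1..l. mset (map snd (w ! (r - 1)))) (Letter t s) =
     (\<Sum>p=1..l. \<Sum>i\<in>{i. 1 \<le> i \<and> B p s i t \<noteq> []}. sum_list (B p s i t))"
proof -
  have fin: "finite {i. 1 \<le> i \<and> B p s i t \<noteq> []}" for p
    by (rule finite_subset[OF _ finite_imageI[OF finite_entry[OF B], of "\<lambda>c. base (fst c)"]])
      (force intro: image_eqI[of _ _ "(Letter _ p, Letter t s)"])
  have "(\<Sum>c\<in>{c. snd c = Letter t s \<and> entry B c \<noteq> []}. sum_list (entry B c)) =
      (\<Sum>(p, i)\<in>(SIGMA p:{1..l}. {i. 1 \<le> i \<and> B p s i t \<noteq> []}). sum_list (B p s i t))"
    by (rule sum.reindex_bij_witness[of _ "\<lambda>(p, i). (Letter i p, Letter t s)"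
            "\<lambda>c. (sub (fst c), base (fst c))"])
      (auto simp: entry_def mem_letters dest: BCM_shape_entry(3)[OF B, unfolded entry_def, simplified])
  then show ?thesis
    using fin by (simp add: count_sum_image_entry sum.Sigma del: One_nat_def)
qed

end

section \<open>Restoring the sum conditions\<close>

text \<open>Every letter of a biword lies in one of the two alphabets, whose subscripts are at most
  \<open>l\<close>.\<close>

lemma BW_imp_shape:
  assumes "length \<nu> = l" "length \<mu> = l" "w \<in> BW l \<nu> \<mu>"
  shows "BW_shape l w"
proof -
  have "sub x \<le> l \<and> sub y \<le> l" if "r \<in> {1..l}" "(x, y) \<in> set (w ! (r - 1))" for r x y
  proof -
    have "x \<in># (\<Sum>r=1..l. mset (map fst (w ! (r - 1))))"
      "y \<in># (\<Sum>r=1..l. mset (map snd (w ! (r - 1))))"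
      using that by (force simp: set_mset_sum)+
    then have "x \<in># alphabet \<nu>" "y \<in># alphabet \<mu>"
      using assms(3) by (simp_all add: BW_def)
    then show ?thesis using assms(1,2) by (auto dest: mem_alphabetD)
  qed
  then show ?thesis
    using assms(3) by (fastforce simp: BW_def BW_shape_def)
qed

text \<open>For a corresponding pair, the top rows form the alphabet of \<nu> exactly when the row
  sums are right, and the bottom rows that of \<mu> exactly when the column sums are.\<close>

lemma BCM_iff_BW:
  assumes "length \<nu> = l" "length \<mu> = l"
    and "BCM_shape l B" "BW_shape l w" "corresponds l B w"
  shows "B \<in> BCM l \<nu> \<mu> \<longleftrightarrow> w \<in> BW l \<nu> \<mu>"
proof -
  let ?top = "\<Sum>r=1..l. mset (map fst (w ! (r - 1)))"
  let ?bot = "\<Sum>r=1..l. mset (map snd (w ! (r - 1)))"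
  have "x \<in> letters \<and> sub x \<le> l" if "x \<in># ?top" for x
    using that BW_shape_mem[OF assms(4)] by (fastforce simp: set_mset_sum)
  then have top: "?top = alphabet \<nu> \<longleftrightarrow>
      (\<forall>s\<in>{1..l}. \<forall>t\<ge>1. count ?top (Letter t s) = part (\<nu> ! (s - 1)) t)"
    by (rule alphabet_eq_iff[OF assms(1)])
  have "x \<in> letters \<and> sub x \<le> l" if "x \<in># ?bot" for x
    using that BW_shape_mem[OF assms(4)] by (fastforce simp: set_mset_sum)
  then have bot: "?bot = alphabet \<mu> \<longleftrightarrow>
      (\<forall>s\<in>{1..l}. \<forall>t\<ge>1. count ?bot (Letter t s) = part (\<mu> ! (s - 1)) t)"
    by (rule alphabet_eq_iff[OF assms(2)])
  have "w \<in> BW l \<nu> \<mu> \<longleftrightarrow> ?top = alphabet \<nu> \<and> ?bot = alphabet \<mu>"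
    using assms(4) unfolding BW_def BW_shape_def by fastforce
  also have "\<dots> \<longleftrightarrow> B \<in> BCM l \<nu> \<mu>"
    unfolding top bot count_top[OF assms(3-5)] count_bottom[OF assms(3-5)]
    using assms(3) unfolding BCM_def BCM_shape_def by blast
  finally show ?thesis by simp
qed

theorem lemma3p3:
  fixes l n :: nat and \<mu> \<nu> :: "nat list list"
  assumes "l \<ge> 1" and "n \<ge> 1"
    and "multicomposition l n \<mu>" and "multicomposition l n \<nu>"
  shows "\<exists>\<Phi>. bij_betw \<Phi> (BCM l \<nu> \<mu>) (BW l \<nu> \<mu>) \<and>
    (\<forall>B\<in>BCM l \<nu> \<mu>. corresponds l B (\<Phi> B))"
proof -
  have len: "length \<nu> = l" "length \<mu> = l"
    using assms(3,4) by (auto simp: multicomposition_def)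
  have BCM_shape: "BCM_shape l B" if "B \<in> BCM l \<nu> \<mu>" for B
    using that unfolding BCM_def BCM_shape_def by blast
  note BW_shape = BW_imp_shape[OF len]
  have "\<forall>B\<in>BCM l \<nu> \<mu>. \<exists>w. w \<in> BW l \<nu> \<mu> \<and> corresponds l B w"
    using ex_BW_shape BCM_shape BCM_iff_BW[OF len] by blast
  then obtain \<Phi> where \<Phi>: "\<And>B. B \<in> BCM l \<nu> \<mu> \<Longrightarrow> \<Phi> B \<in> BW l \<nu> \<mu> \<and> corresponds l B (\<Phi> B)"
    by metis
  \<comment> \<open>Two matrices with the same image both correspond to it, hence agree.\<close>
  have "inj_on \<Phi> (BCM l \<nu> \<mu>)"
    by (rule inj_onI) (metis \<Phi> BCM_shape BW_shape BCM_shape_unique)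
  moreover have "w \<in> \<Phi> ` BCM l \<nu> \<mu>" if w: "w \<in> BW l \<nu> \<mu>" for w
  proof -
    \<comment> \<open>The sum conditions pass from \<open>w\<close> to \<open>B\<close>; then
      \<open>\<Phi> B\<close> and \<open>w\<close> both correspond to \<open>B\<close> and so
      coincide.\<close>
    obtain B where "BCM_shape l B" "corresponds l B w"
      using ex_BCM_shape BW_shape w by blast
    then show ?thesis
      using \<Phi> w BW_shape BCM_iff_BW[OF len] BW_shape_unique by (metis image_eqI)
  qed
  ultimately have "bij_betw \<Phi> (BCM l \<nu> \<mu>) (BW l \<nu> \<mu>)"
    using \<Phi> by (auto simp: bij_betw_def)
  then show ?thesis using \<Phi> by blast
qed

end
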